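(* Let $\mathbb{P}$ be an orthocomplete orthoposet with greatest element $1=\bigvee\mathbb{P}$, let $Z\subseteq\mathrm{C}(\mathbb{P})$ be a complete sublattice of $\mathbb{P}$ with $Z^\perp=Z$, and let $I\subseteq\mathbb{P}$ be order-dense and $Z$-complete. Then $1$ is $\mathrm{H}_{I,Z}$-subhomogeneous. If, further, $I_\lambda\cap I_\kappa\cap Z=\{0\}$ whenever $\lambda\neq\kappa$, then there are unique orthogonal $(z_\kappa)\subseteq Z$ with $z_\kappa\in I_\kappa$ for all $\kappa$, and $1=\bigvee_\kappa z_\kappa$. (Here $\lambda,\kappa$ range over cardinals.)
   Context: Suprema $\bigvee,\vee$ and infima $\bigwedge,\wedge$ are taken in $\mathbb{P}$; any assertion involving one includes its existence. $[0,z]=\{p\in\mathbb{P}:p\leq z\}$ and $[p,1]=\{q\in\mathbb{P}:p\leq q\}$. An orthoposet is a poset $\mathbb{P}$ with least element $0$ and greatest element $1$ together with an order-reversing involution $p\mapsto p^\perp$ such that $p\wedge p^\perp=0$ and $p\vee p^\perp=1$ for all $p$. Write $p\perp q$ ($p,q$ are orthogonal) if $p\leq q^\perp$. $\mathbb{P}$ is orthocomplete if $\bigvee S$ exists for every pairwise orthogonal $S\subseteq\mathbb{P}$. $Z^\perp=\{z^\perp:z\in Z\}$. $\mathrm{C}(\mathbb{P})$ denotes the centre of $\mathbb{P}$, i.e. the set of central elements: $z\in\mathbb{P}$ is central if there exists $z'\in\mathbb{P}$ such that $\psi(p)=(p\wedge z,p\wedge z')$ and $\phi(p,q)=p\vee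 q$ are well-defined mutually inverse order isomorphisms $\psi:\mathbb{P}\to[0,z]\times[0,z']$ and $\phi:[0,z]\times[0,z']\to\mathbb{P}$ (with the product order). $Z\subseteq\mathbb{P}$ is a complete sublattice of $\mathbb{P}$ if every $S\subseteq Z$ has both a supremum and an infimum in $\mathbb{P}$, and these belong to $Z$. A set $S\subseteq\mathbb{P}$ is $Z$-disjoint if there is $f:S\to Z$ with $p\leq f(p)$ for all $p\in S$ and $f(p)\wedge f(q)=0$ for all distinct $p,q\in S$. A set $I\subseteq\mathbb{P}$ is $Z$-complete if (1) $\bigvee S\in I$ whenever $S\subseteq I$ is $Z$-disjoint, and (2) $p,q\in I$ whenever $p\vee q\in I$ and $\{p,q\}$ is $Z$-disjoint. $I\subseteq\mathbb{P}$ is order-dense if every non-zero $p\in\mathbb{P}$ dominates some non-zero $q\in I$ (i.e. $0\neq q\leq p$). Write $p\sim_Zq$ if $[p,1]\cap Z=[q,1]\cap Z$. The homogeneity relation $\mathrm{H}_{I,Z}$ on $\mathbb{P}$ is: $p\,\mathrm{H}_{I,Z}\,q$ if and only if $p,q\in I$, $p\perp q$ and $p\sim_Zq$. For a binary relation $R$ on $\mathbb{P}$, an element $p\in\mathbb{P}$ is $R$-homogeneous if $p=\bigvee S$ for some set $S\subseteq\mathbb{P}$ such that $s\,R\,t$ for all distinct $s,t\in S$; such a $p$ has order $\kappa$ when $|S|=\kappa$. The order need not be uniquely defined. An element $p\in\mathbb{P}$ is $R$-subhomogeneous if $p=\bigvee S$ for some $Z$-disjoint $S\subseteq\mathbb{P}$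 consisting of $R$-homogeneous elements. $I_\kappa$ denotes the set of all $p\in\mathbb{P}$ that are $\mathrm{H}_{I,Z}$-homogeneous of order $\kappa$, i.e. for which there is at least one set $S$ of cardinality $\kappa$ witnessing the $\mathrm{H}_{I,Z}$-homogeneity of $p$.
   Formalization: Since 0 is not in I_κ for κ≥2, the condition I_λ∩I_κ∩Z={0} is read as "⊆{0}" and z_κ∈I_κ as "z_κ∈I_κ or z_κ=0"; cardinals range up to |P|. The result is also proved with homogeneity witnesses S required to lie in I. *)

theory Defs
  imports "HOL-Library.Lub_Glb" "HOL-Library.Equipollence" "HOL-Library.FuncSet"
    "HOL-Library.Product_Order"
begin

text \<open>
  Suprema and infima in the ambient poset are the relations \<^term>\<open>isLub UNIV\<close> and
  \<^term>\<open>isGlb UNIV\<close>, so asserting one of them includes asserting that it exists.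
\<close>

class orthoposet = order_bot + order_top +
  fixes ortho :: "'a \<Rightarrow> 'a"
  assumes ortho_antimono: "p \<le> q \<Longrightarrow> ortho q \<le> ortho p"
    and ortho_ortho: "ortho (ortho p) = p"
    and inf_ortho_le: "r \<le> p \<Longrightarrow> r \<le> ortho p \<Longrightarrow> r \<le> bot"
    and sup_ortho_ge: "p \<le> r \<Longrightarrow> ortho p \<le> r \<Longrightarrow> top \<le> r"

lemma inf_ortho: "isGlb UNIV {p, ortho p} (bot :: 'a::orthoposet)"
  by (auto simp: isGlb_def greatestP_def isLb_def setge_def setle_def intro: inf_ortho_le)

lemma sup_ortho: "isLub UNIV {p, ortho p} (top :: 'a::orthoposet)"
  by (auto simp: isLub_def leastP_def isUb_def setge_def setle_def intro: sup_ortho_ge)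

definition orthogonal :: "'a::orthoposet \<Rightarrow> 'a \<Rightarrow> bool"
  where "orthogonal p q \<longleftrightarrow> p \<le> ortho q"

definition orthocomplete :: "'a::orthoposet itself \<Rightarrow> bool"
  where "orthocomplete _ \<longleftrightarrow> (\<forall>S::'a set. pairwise orthogonal S \<longrightarrow> (\<exists>s. isLub UNIV S s))"

text \<open>
  The interval from \<^term>\<open>bot\<close> to \<open>z\<close> is \<^term>\<open>{..z}\<close>, and pairs carry the product order.
  Two monotone maps that are inverse to each other are order isomorphisms; that
  \<open>\<psi>\<close> has values in the product of the intervals is part of its being a pair of infima.
\<close>

definition central :: "'a::order_bot \<Rightarrow> bool"
  where "central z \<longleftrightarrow> (\<exists>z' (\<psi> :: 'a \<Rightarrow> 'a \<times> 'a) (\<phi> :: 'a \<times> 'a \<Rightarrow> 'a).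
    (\<forall>p. isGlb UNIV {p, z} (fst (\<psi> p)) \<and> isGlb UNIV {p, z'} (snd (\<psi> p))) \<and>
    (\<forall>p\<in>{..z}. \<forall>q\<in>{..z'}. isLub UNIV {p, q} (\<phi> (p, q))) \<and>
    (\<forall>p. \<phi> (\<psi> p) = p) \<and>
    (\<forall>x\<in>{..z} \<times> {..z'}. \<psi> (\<phi> x) = x) \<and>
    mono \<psi> \<and> mono_on ({..z} \<times> {..z'}) \<phi>)"

definition centre :: "'a::order_bot set"
  where "centre = {z. central z}"

definition complete_sublattice :: "'a::order set \<Rightarrow> bool"
  where "complete_sublattice Z \<longleftrightarrow>
    (\<forall>S\<subseteq>Z. (\<exists>s\<in>Z. isLub UNIV S s) \<and> (\<exists>i\<in>Z. isGlb UNIV S i))"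

definition disjoint_over :: "'a::order_bot set \<Rightarrow> 'a set \<Rightarrow> bool"
  where "disjoint_over Z S \<longleftrightarrow> (\<exists>f\<in>S \<rightarrow> Z.
    (\<forall>p\<in>S. p \<le> f p) \<and>
    (\<forall>p\<in>S. \<forall>q\<in>S. p \<noteq> q \<longrightarrow> isGlb UNIV {f p, f q} bot))"

definition complete_over :: "'a::order_bot set \<Rightarrow> 'a set \<Rightarrow> bool"
  where "complete_over Z I \<longleftrightarrow>
    (\<forall>S\<subseteq>I. disjoint_over Z S \<longrightarrow> (\<exists>s\<in>I. isLub UNIV S s)) \<and>
    (\<forall>p q. (\<exists>r\<in>I. isLub UNIV {p, q} r) \<and> disjoint_over Z {p, q} \<longrightarrow> p \<in> I \<and> q \<in> I)"

definition order_dense :: "'a::order_bot set \<Rightarrow> bool"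
  where "order_dense I \<longleftrightarrow> (\<forall>p. p \<noteq> bot \<longrightarrow> (\<exists>q\<in>I. q \<noteq> bot \<and> q \<le> p))"

definition same_upper :: "'a::order set \<Rightarrow> 'a \<Rightarrow> 'a \<Rightarrow> bool"
  where "same_upper Z p q \<longleftrightarrow> {p..} \<inter> Z = {q..} \<inter> Z"

definition homogeneity :: "'a::orthoposet set \<Rightarrow> 'a set \<Rightarrow> 'a \<Rightarrow> 'a \<Rightarrow> bool"
  where "homogeneity I Z p q \<longleftrightarrow> p \<in> I \<and> q \<in> I \<and> orthogonal p q \<and> same_upper Z p q"

text \<open>
  The type \<open>'a cardinal\<close> consists of the cardinals up to that of \<^typ>\<open>'a\<close>, as equipotence
  classes of sets. A set of elements of \<^typ>\<open>'a\<close> has no larger cardinality, so no larger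
  cardinal is the order of an element.
\<close>

quotient_type 'a cardinal = "'a set" / "eqpoll :: 'a set \<Rightarrow> 'a set \<Rightarrow> bool"
  by (rule equivpI) (auto simp: reflp_def symp_def transp_def intro: eqpoll_sym eqpoll_trans)

lift_definition cardinality :: "'a set \<Rightarrow> 'a cardinal" is "\<lambda>S. S" .

text \<open>
  In the following definitions the witnessing sets \<open>S\<close> of homogeneity are drawn from \<open>A\<close>;
  the usual notions (any subset \<open>S\<close> of the poset) are those for \<open>A = UNIV\<close>. A singleton
  satisfies any condition on pairs of distinct elements, so for \<open>A = UNIV\<close> every
  element is homogeneous of order one. For \<open>R = homogeneity I Z\<close> the case \<open>A = I\<close> differs
  from \<open>A = UNIV\<close> in these singletons only.
\<close>

definition homogeneous_of_order ::
    "'a::order set \<Rightarrow> ('a \<Rightarrow> 'a \<Rightarrow> bool) \<Rightarrow> 'a cardinal \<Rightarrow> 'a \<Rightarrow> bool"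
  where "homogeneous_of_order A R \<kappa> p \<longleftrightarrow>
    (\<exists>S\<subseteq>A. isLub UNIV S p \<and> pairwise R S \<and> cardinality S = \<kappa>)"

definition homogeneous :: "'a::order set \<Rightarrow> ('a \<Rightarrow> 'a \<Rightarrow> bool) \<Rightarrow> 'a \<Rightarrow> bool"
  where "homogeneous A R p \<longleftrightarrow> (\<exists>S\<subseteq>A. isLub UNIV S p \<and> pairwise R S)"

definition subhomogeneous ::
    "'a::order_bot set \<Rightarrow> 'a set \<Rightarrow> ('a \<Rightarrow> 'a \<Rightarrow> bool) \<Rightarrow> 'a \<Rightarrow> bool"
  where "subhomogeneous A Z R p \<longleftrightarrow>
    (\<exists>S. isLub UNIV S p \<and> disjoint_over Z S \<and> (\<forall>s\<in>S. homogeneous A R s))"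

definition order_part ::
    "'a::orthoposet set \<Rightarrow> 'a set \<Rightarrow> 'a set \<Rightarrow> 'a cardinal \<Rightarrow> 'a set"
  where "order_part A I Z \<kappa> = {p. homogeneous_of_order A (homogeneity I Z) \<kappa> p}"

text \<open>
  \<^term>\<open>bot\<close> is the supremum of \<^term>\<open>{}\<close> and \<^term>\<open>{bot}\<close> only, so it is homogeneous of no
  order above one. A family with one member of each order, where some members may vanish, takes
  its values in \<^const>\<open>order_part\<close> with \<^term>\<open>bot\<close> adjoined.
\<close>

end

theory Submission
  imports Defs
begin

text \<open>
  Below every non-zero element of \<open>Z\<close> there is a non-zero homogeneous one. Choose \<open>p \<in> I\<close> below
  the given element, let \<open>w\<close> be the least element of \<open>Z\<close> above \<open>p\<close>, and let \<open>s\<close> be the supremum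
  of a maximal orthogonal set of elements of \<open>I\<close> with the same upper bounds in \<open>Z\<close> as \<open>p\<close>.
  A maximal \<open>Z\<close>-disjoint family in \<open>I\<close> below \<open>s\<^sup>\<bottom> \<and> w\<close> has a supremum \<open>q \<in> I\<close>; let \<open>v\<close> be the
  least element of \<open>Z\<close> above \<open>q\<close>. Maximality of the orthogonal set excludes \<open>v = w\<close>, and
  maximality of the disjoint family gives \<open>s\<^sup>\<bottom> \<and> w \<and> v\<^sup>\<bottom> = 0\<close>. Hence \<open>w \<and> v\<^sup>\<bottom>\<close> lies below \<open>s\<close>, and
  cutting the orthogonal set down to it shows that it is homogeneous. A maximal orthogonal family
  of homogeneous elements of \<open>Z\<close> then has supremum \<open>1\<close>.

  Merging the members of such a family that have the same order yields the elements \<open>z\<^sub>\<kappa>\<close>.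
  For uniqueness, the meet of \<open>z\<^sub>\<kappa>\<close> with \<open>z'\<^sub>\<mu>\<close> is zero or has both orders \<open>\<kappa>\<close> and \<open>\<mu>\<close>.
\<close>

section \<open>Suprema, infima, orthocomplements and maximal sets\<close>

lemma isLub_UNIV_iff: "isLub UNIV S s \<longleftrightarrow> (\<forall>y. s \<le> y \<longleftrightarrow> (\<forall>x\<in>S. x \<le> (y::'a::order)))"
  unfolding isLub_def leastP_def isUb_def setge_def setle_def
  by (auto intro: order_trans)

lemma isGlb_UNIV_iff: "isGlb UNIV S s \<longleftrightarrow> (\<forall>y. y \<le> s \<longleftrightarrow> (\<forall>x\<in>S. (y::'a::order) \<le> x))"
  unfolding isGlb_def greatestP_def isLb_def setge_def setle_def
  by (auto intro: order_trans)

lemma isLub_UNIV_unique: "isLub UNIV S s \<Longrightarrow> isLub UNIV S t \<Longrightarrow> s = (t::'a::order)"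
  by (meson isLub_UNIV_iff order.antisym order_refl)

lemma isGlb_UNIV_unique: "isGlb UNIV S s \<Longrightarrow> isGlb UNIV S t \<Longrightarrow> s = (t::'a::order)"
  by (meson isGlb_UNIV_iff order.antisym order_refl)

lemma same_upper_iff: "same_upper Z p q \<longleftrightarrow> (\<forall>z\<in>Z. p \<le> z \<longleftrightarrow> q \<le> z)"
  by (auto simp: same_upper_def)

lemma cardinality_eq_iff: "cardinality S = cardinality T \<longleftrightarrow> S \<approx> T"
  by transfer simp

lemma homogeneous_iff_of_order:
  "homogeneous A R p \<longleftrightarrow> (\<exists>\<kappa>. homogeneous_of_order A R \<kappa> p)"
  by (auto simp: homogeneous_def homogeneous_of_order_def)

lemma le_ortho_sym: "p \<le> ortho q \<Longrightarrow> q \<le> ortho (p::'a::orthoposet)"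
  by (metis ortho_antimono ortho_ortho)

lemma ortho_le_sym: "ortho p \<le> q \<Longrightarrow> ortho q \<le> (p::'a::orthoposet)"
  by (metis ortho_antimono ortho_ortho)

lemma le_ortho_self: "(p::'a::orthoposet) \<le> ortho p \<Longrightarrow> p = bot"
  using inf_ortho_le[of p p] by (simp add: bot_unique)

text \<open>Zorn's lemma, with maximality phrased elementwise: whatever could be added to
  \<open>S\<close> is already in it. Both directions of \<open>R\<close> are asked for because
  \<open>R\<close> may fail to be symmetric.\<close>

lemma maximal_pairwise_subset:
  obtains S where "S \<subseteq> D" "pairwise R S"
    "\<And>x. x \<in> D \<Longrightarrow> (\<And>y. y \<in> S \<Longrightarrow> R x y \<and> R y x) \<Longrightarrow> x \<in> S"
proof -
  let ?F = "{S. S \<subseteq> D \<and> pairwise R S}"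
  have "\<exists>M\<in>?F. \<forall>X\<in>?F. M \<subseteq> X \<longrightarrow> X = M"
  proof (rule subset_Zorn')
    fix C assume C: "subset.chain ?F C"
    have "pairwise R (\<Union>C)"
    proof (rule pairwiseI)
      fix x y assume "x \<in> \<Union>C" "y \<in> \<Union>C" "x \<noteq> y"
      then obtain X Y where XY: "X \<in> C" "Y \<in> C" "x \<in> X" "y \<in> Y" by blast
      with C have "X \<subseteq> Y \<or> Y \<subseteq> X" by (auto simp: subset_chain_def)
      with XY have "x \<in> X \<and> y \<in> X \<or> x \<in> Y \<and> y \<in> Y" by blast
      moreover have "pairwise R X" "pairwise R Y" using XY C by (auto simp: subset_chain_def)
      ultimately show "R x y" using \<open>x \<noteq> y\<close> by (blast dest: pairwiseD)
    qed
    with C show "\<Union>C \<in> ?F" by (auto simp: subset_chain_def)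
  qed
  then obtain S where S: "S \<subseteq> D" "pairwise R S" and
    max: "\<And>X. X \<subseteq> D \<Longrightarrow> pairwise R X \<Longrightarrow> S \<subseteq> X \<Longrightarrow> X = S" by auto
  show thesis
  proof (rule that[OF S])
    fix x assume "x \<in> D" "\<And>y. y \<in> S \<Longrightarrow> R x y \<and> R y x"
    with S have "insert x S = S" by (intro max) (auto simp: pairwise_insert)
    then show "x \<in> S" by blast
  qed
qed

section \<open>Meets with central elements\<close>

definition meet :: "'a::order \<Rightarrow> 'a \<Rightarrow> 'a"
  where "meet p z = (THE m. isGlb UNIV {p, z} m)"

lemma meet_eqI: "isGlb UNIV {p, z} m \<Longrightarrow> meet p z = m"
  unfolding meet_def by (blast intro: isGlb_UNIV_unique)

lemma meet_commute: "meet p z = meet z p"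
  by (simp add: meet_def insert_commute)

text \<open>The \<open>z'\<close> in the definition of centrality must be \<open>ortho z\<close>.
  The first component of \<open>ortho z\<close> vanishes, so \<open>ortho z\<close> lies below
  \<open>z'\<close>. Conversely \<open>\<phi>\<close> sends \<open>(z, ortho z)\<close> to
  \<open>top\<close>, whose second component is \<open>z'\<close>.\<close>

lemma central_complement:
  fixes z :: "'a::orthoposet"
  assumes "central z"
  obtains \<psi> \<phi> where
    "\<And>p. isGlb UNIV {p, z} (fst (\<psi> p))" "\<And>p. isGlb UNIV {p, ortho z} (snd (\<psi> p))"
    "\<And>p q. p \<le> z \<Longrightarrow> q \<le> ortho z \<Longrightarrow> isLub UNIV {p, q} (\<phi> (p, q))"
    "\<And>p. \<phi> (\<psi> p) = p"
    "\<And>p q. p \<le> z \<Longrightarrow> q \<le> ortho z \<Longrightarrow> \<psi> (\<phi> (p, q)) = (p, q)"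
proof -
  obtain z' and \<psi> :: "'a \<Rightarrow> 'a \<times> 'a" and \<phi> where
    "(\<forall>p. isGlb UNIV {p, z} (fst (\<psi> p)) \<and> isGlb UNIV {p, z'} (snd (\<psi> p))) \<and>
    (\<forall>p\<in>{..z}. \<forall>q\<in>{..z'}. isLub UNIV {p, q} (\<phi> (p, q))) \<and>
    (\<forall>p. \<phi> (\<psi> p) = p) \<and> (\<forall>x\<in>{..z} \<times> {..z'}. \<psi> (\<phi> x) = x)"
    using assms unfolding central_def by blast
  then have g: "isGlb UNIV {p, z} (fst (\<psi> p))" "isGlb UNIV {p, z'} (snd (\<psi> p))" and
    l: "p \<le> z \<Longrightarrow> q \<le> z' \<Longrightarrow> isLub UNIV {p, q} (\<phi> (p, q))" and
    inv: "\<phi> (\<psi> p) = p" "p \<le> z \<Longrightarrow> q \<le> z' \<Longrightarrow> \<psi> (\<phi> (p, q)) = (p, q)" for p q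
    by auto
  have le: "fst (\<psi> p) \<le> p" "fst (\<psi> p) \<le> z" "snd (\<psi> p) \<le> z'" "snd (\<psi> p) \<le> p" for p
    using g[of p] unfolding isGlb_UNIV_iff by auto
  let ?b = "snd (\<psi> (ortho z))"
  have "fst (\<psi> (ortho z)) \<le> bot"
    using le by (intro inf_ortho_le[of _ z])
  moreover have "isLub UNIV {fst (\<psi> (ortho z)), ?b} (ortho z)"
    using l[of "fst (\<psi> (ortho z))" ?b] le inv(1) by auto
  ultimately have "ortho z \<le> ?b"
    unfolding isLub_UNIV_iff by (auto intro: order_trans)
  then have z': "ortho z \<le> z'" using le(3) by (rule order_trans)
  have "isLub UNIV {z, ortho z} (\<phi> (z, ortho z))" using z' by (intro l) auto
  then have "\<phi> (z, ortho z) = top" using sup_ortho isLub_UNIV_unique by blast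
  then have "snd (\<psi> top) = ortho z" using inv(2)[of z "ortho z"] z' by simp
  moreover have "z' \<le> snd (\<psi> top)" using g(2)[of top] unfolding isGlb_UNIV_iff by auto
  ultimately have "z' = ortho z" using z' by auto
  with g l inv show thesis using that by blast
qed

locale central_sublattice =
  fixes Z :: "'a::orthoposet set"
  assumes orthocomplete: "orthocomplete TYPE('a)"
    and centre: "Z \<subseteq> centre"
    and complete: "complete_sublattice Z"
    and ortho_image: "ortho ` Z = Z"
begin

lemma ortho_in: "z \<in> Z \<Longrightarrow> ortho z \<in> Z"
  using ortho_image by blast

lemma le_meet_iff [simp]:
  assumes "z \<in> Z"
  shows "x \<le> meet p z \<longleftrightarrow> x \<le> p \<and> x \<le> z"
proof -
  from assms centre have "central z" by (auto simp: centre_def)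
  then obtain m where m: "isGlb UNIV {p, z} m" by (meson central_complement)
  then show ?thesis using meet_eqI[OF m] by (simp add: isGlb_UNIV_iff)
qed

lemma meet_le:
  assumes "z \<in> Z"
  shows "meet p z \<le> p" "meet p z \<le> z"
  using le_meet_iff[OF assms, of "meet p z" p] by auto

lemma meet_mono: "z \<in> Z \<Longrightarrow> p \<le> q \<Longrightarrow> meet p z \<le> meet q z"
  using meet_le[of z p] by (auto intro: order_trans)

lemma meet_top: "z \<in> Z \<Longrightarrow> meet top z = z"
  by (simp add: meet_le order.antisym)

text \<open>Since \<open>\<phi>\<close> inverts \<open>\<psi>\<close>, \<open>p\<close> is the
  supremum of its parts in \<open>z\<close> and in \<open>ortho z\<close>.\<close>

lemma le_by_parts:
  assumes "z \<in> Z" "meet p z \<le> x" "meet p (ortho z) \<le> x"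
  shows "p \<le> x"
proof -
  from assms centre have "central z" by (auto simp: centre_def)
  then obtain \<psi> \<phi> where
    g: "\<And>p. isGlb UNIV {p, z} (fst (\<psi> p))" "\<And>p. isGlb UNIV {p, ortho z} (snd (\<psi> p))" and
    l: "\<And>p q. p \<le> z \<Longrightarrow> q \<le> ortho z \<Longrightarrow> isLub UNIV {p, q} (\<phi> (p, q))" and
    i: "\<And>p. \<phi> (\<psi> p) = p"
    by (rule central_complement) blast
  have "\<psi> p = (meet p z, meet p (ortho z))"
    using g[of p] by (auto dest!: meet_eqI intro: prod_eqI)
  then have "isLub UNIV {meet p z, meet p (ortho z)} p"
    using l[of "meet p z" "meet p (ortho z)"] i[of p] assms(1)
    by (auto simp: meet_le ortho_in)
  with assms show ?thesis by (auto simp: isLub_UNIV_iff)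
qed

text \<open>The right adjoint of \<open>meet \<cdot> z\<close> is implication: \<open>ortho (meet (ortho u) z)\<close> is \<open>z\<^sup>\<bottom> \<or> u\<close>.\<close>

lemma meet_le_iff:
  assumes z: "z \<in> Z"
  shows "meet t z \<le> u \<longleftrightarrow> t \<le> ortho (meet (ortho u) z)"
proof
  assume tu: "meet t z \<le> u"
  have "u \<le> ortho (meet (ortho u) z)"
    using meet_le(1)[OF z] by (rule le_ortho_sym)
  moreover have "ortho z \<le> ortho (meet (ortho u) z)"
    using meet_le(2)[OF z] by (rule ortho_antimono)
  ultimately show "t \<le> ortho (meet (ortho u) z)"
    using tu z meet_le(2)[OF ortho_in[OF z]] by (blast intro: le_by_parts order_trans)
next
  assume t: "t \<le> ortho (meet (ortho u) z)"
  from z centre have "central z" by (auto simp: centre_def)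
  then obtain \<psi> \<phi> where
    g: "\<And>p. isGlb UNIV {p, z} (fst (\<psi> p))" and
    l: "\<And>p q. p \<le> z \<Longrightarrow> q \<le> ortho z \<Longrightarrow> isLub UNIV {p, q} (\<phi> (p, q))" and
    i: "\<And>p q. p \<le> z \<Longrightarrow> q \<le> ortho z \<Longrightarrow> \<psi> (\<phi> (p, q)) = (p, q)"
    by (rule central_complement) blast
  \<comment> \<open>\<open>r\<close> is the supremum of \<open>u\<close> and \<open>ortho z\<close>,
    built from a pair so that \<open>\<psi>\<close> reveals its part in \<open>z\<close> to be
    \<open>meet u z\<close>. As \<open>ortho r\<close> lies below \<open>meet (ortho u) z\<close>,
    the assumption gives \<open>t \<le> r\<close>.\<close>
  define r where "r = \<phi> (meet u z, ortho z)"
  have r: "isLub UNIV {meet u z, ortho z} r" and ri: "meet r z = meet u z"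
    using l[of "meet u z" "ortho z"] i[of "meet u z" "ortho z"] g[of r, THEN meet_eqI] z
    by (auto simp: r_def meet_le)
  then have ub: "meet u z \<le> r" "ortho z \<le> r" by (auto simp: isLub_UNIV_iff)
  have "u \<le> r"
    using z ub meet_le(2)[OF ortho_in[OF z]] by (blast intro: le_by_parts order_trans)
  then have "ortho r \<le> meet (ortho u) z"
    using ub z by (simp add: ortho_antimono ortho_le_sym)
  then have "t \<le> r" using t by (blast intro: ortho_le_sym order_trans)
  then have "meet t z \<le> meet u z" using meet_mono[OF z, of t r] ri by simp
  then show "meet t z \<le> u" using z by simp
qed

text \<open>A map with a right adjoint preserves all existing suprema.\<close>

lemma meet_isLub:
  assumes "isLub UNIV S s" "z \<in> Z"
  shows "isLub UNIV ((\<lambda>t. meet t z) ` S) (meet s z)"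
  using assms by (auto simp: isLub_UNIV_iff meet_le_iff)

lemma Lub_in:
  assumes "S \<subseteq> Z" "isLub UNIV S s"
  shows "s \<in> Z"
  using assms complete isLub_UNIV_unique unfolding complete_sublattice_def by metis

lemma ex_Lub: "S \<subseteq> Z \<Longrightarrow> \<exists>s\<in>Z. isLub UNIV S s"
  using complete unfolding complete_sublattice_def by blast

lemma meet_in:
  assumes "y \<in> Z" "z \<in> Z"
  shows "meet y z \<in> Z"
proof -
  obtain m where "m \<in> Z" "isGlb UNIV {y, z} m"
    using complete assms unfolding complete_sublattice_def by (meson empty_subsetI insert_subset)
  then show ?thesis using meet_eqI by metis
qed

text \<open>If the part of \<open>y\<close> in \<open>z\<close> vanishes, then \<open>y\<close> is
  its part in \<open>ortho z\<close>; this direction rests on centrality.\<close>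

lemma disjoint_iff_orthogonal:
  assumes "y \<in> Z" "z \<in> Z"
  shows "isGlb UNIV {y, z} bot \<longleftrightarrow> orthogonal y z"
proof
  assume "isGlb UNIV {y, z} bot"
  then have "meet y z = bot" by (rule meet_eqI)
  then show "orthogonal y z"
    using le_by_parts[OF assms(2), of y] meet_le(2)[OF ortho_in[OF assms(2)]]
    by (simp add: orthogonal_def)
next
  assume "orthogonal y z"
  then show "isGlb UNIV {y, z} bot"
    by (auto simp: isGlb_UNIV_iff orthogonal_def intro: order_trans inf_ortho_le)
qed

section \<open>Central covers relative to \<open>Z\<close> and \<open>Z\<close>-disjointness\<close>

definition cover :: "'a \<Rightarrow> 'a"
  where "cover p = (THE c. isGlb UNIV ({p..} \<inter> Z) c)"

lemma cover_isGlb: "isGlb UNIV ({p..} \<inter> Z) (cover p) \<and> cover p \<in> Z"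
proof -
  obtain c where "c \<in> Z" "isGlb UNIV ({p..} \<inter> Z) c"
    using complete unfolding complete_sublattice_def by (meson inf_le2)
  moreover from this have "cover p = c"
    unfolding cover_def by (blast intro: isGlb_UNIV_unique)
  ultimately show ?thesis by simp
qed

lemma cover_in [simp]: "cover p \<in> Z"
  using cover_isGlb by blast

lemma le_cover: "p \<le> cover p"
  using cover_isGlb[of p] unfolding isGlb_UNIV_iff by auto

lemma cover_le_iff: "z \<in> Z \<Longrightarrow> cover p \<le> z \<longleftrightarrow> p \<le> z"
  using cover_isGlb[of p] le_cover[of p] unfolding isGlb_UNIV_iff
  by (auto intro: order_trans)

lemma same_upper_iff_cover: "same_upper Z p q \<longleftrightarrow> cover p = cover q"
proof
  assume "same_upper Z p q"
  then show "cover p = cover q"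
    by (metis (no_types) cover_in cover_le_iff order.antisym order_refl same_upper_iff)
next
  assume "cover p = cover q"
  then show "same_upper Z p q" unfolding same_upper_iff by (metis cover_le_iff)
qed

text \<open>\<open>Z\<close>-disjointness as a condition on pairs, with \<open>cover\<close> as the
  canonical bounding map; in this form maximal \<open>Z\<close>-disjoint sets come from
  \<open>maximal_pairwise_subset\<close>.\<close>

definition separated :: "'a \<Rightarrow> 'a \<Rightarrow> bool"
  where "separated p q \<longleftrightarrow> orthogonal (cover p) (cover q)"

lemma separated_sym: "separated p q \<Longrightarrow> separated q p"
  unfolding separated_def orthogonal_def by (rule le_ortho_sym)

lemma separatedI:
  assumes "y \<in> Z" "z \<in> Z" "orthogonal y z" "p \<le> y" "q \<le> z"
  shows "separated p q"
proof -
  have "cover p \<le> y" "ortho z \<le> ortho (cover q)"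
    using assms by (auto simp: cover_le_iff intro: ortho_antimono)
  with assms(3) show ?thesis
    unfolding separated_def orthogonal_def by (blast intro: order_trans)
qed

lemma separated_mono: "separated p q \<Longrightarrow> p' \<le> p \<Longrightarrow> q' \<le> q \<Longrightarrow> separated p' q'"
  by (rule separatedI[of "cover p" "cover q"])
    (simp_all add: separated_def order_trans[OF _ le_cover])

lemma separated_orthogonal: "separated p q \<Longrightarrow> orthogonal p q"
  unfolding separated_def orthogonal_def
  using le_cover[of p] ortho_antimono[OF le_cover[of q]] by (blast intro: order_trans)

text \<open>Any bounding map \<open>f\<close> dominates \<open>cover\<close>, and orthogonality
  passes to smaller elements.\<close>

lemma disjoint_over_iff: "disjoint_over Z S \<longleftrightarrow> pairwise separated S"
proof
  assume "disjoint_over Z S"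
  then obtain f where f: "f \<in> S \<rightarrow> Z" "\<forall>p\<in>S. p \<le> f p"
    "\<forall>p\<in>S. \<forall>q\<in>S. p \<noteq> q \<longrightarrow> isGlb UNIV {f p, f q} bot"
    unfolding disjoint_over_def by blast
  show "pairwise separated S"
  proof (rule pairwiseI)
    fix p q assume "p \<in> S" "q \<in> S" "p \<noteq> q"
    with f show "separated p q"
      by (intro separatedI[of "f p" "f q"]) (auto simp: disjoint_iff_orthogonal Pi_iff)
  qed
next
  assume "pairwise separated S"
  then show "disjoint_over Z S"
    unfolding disjoint_over_def
    by (intro bexI[of _ cover])
      (auto simp: le_cover disjoint_iff_orthogonal pairwise_def separated_def)
qed

section \<open>Cutting down and gluing homogeneous elements\<close>

text \<open>Separated families are orthogonal, so orthocompleteness supplies their suprema. This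
  allows \<open>A = UNIV\<close> and \<open>A = I\<close> to be treated together.\<close>

lemma complete_over_UNIV: "complete_over Z UNIV"
proof -
  have "\<exists>s. isLub UNIV S s" if "pairwise separated S" for S
  proof -
    have "pairwise orthogonal S" using that separated_orthogonal by (auto simp: pairwise_def)
    then show ?thesis using orthocomplete unfolding orthocomplete_def by blast
  qed
  then show ?thesis unfolding complete_over_def by (auto simp: disjoint_over_iff)
qed

lemma complete_over_Lub:
  assumes "complete_over Z A" "S \<subseteq> A" "pairwise separated S"
  shows "\<exists>s\<in>A. isLub UNIV S s"
  using assms unfolding complete_over_def disjoint_over_iff by blast

text \<open>\<open>p\<close> is the supremum of two \<open>Z\<close>-disjoint parts, so the second
  clause of \<open>Z\<close>-completeness applies.\<close>

lemma complete_over_meet: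
  assumes A: "complete_over Z A" and p: "p \<in> A" and z: "z \<in> Z"
  shows "meet p z \<in> A"
proof -
  have "isLub UNIV {meet p z, meet p (ortho z)} p"
    unfolding isLub_UNIV_iff
    using z ortho_in[OF z] by (auto intro: le_by_parts order_trans meet_le)
  moreover have "separated (meet p z) (meet p (ortho z))"
    by (rule separatedI[of z "ortho z"])
      (use z in \<open>auto simp: ortho_in meet_le orthogonal_def ortho_ortho\<close>)
  then have "disjoint_over Z {meet p z, meet p (ortho z)}"
    unfolding disjoint_over_iff by (auto simp: pairwise_insert separated_sym)
  ultimately show ?thesis using A p unfolding complete_over_def by blast
qed

text \<open>By adjunction, \<open>c\<close> in \<open>Z\<close> bounds \<open>meet p z\<close> iff
  \<open>ortho (meet (ortho c) z)\<close>, again in \<open>Z\<close>, bounds \<open>p\<close>. Hence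
  equal upper bounds stay equal.\<close>

lemma homogeneity_meet:
  assumes I: "complete_over Z I" and z: "z \<in> Z" and h: "homogeneity I Z p q"
  shows "homogeneity I Z (meet p z) (meet q z)"
proof -
  have "ortho (meet (ortho c) z) \<in> Z" if "c \<in> Z" for c
    using that z by (intro ortho_in meet_in)
  with h have "same_upper Z (meet p z) (meet q z)"
    by (simp add: homogeneity_def same_upper_iff meet_le_iff[OF z])
  moreover have "orthogonal (meet p z) (meet q z)"
    using h meet_le(1)[OF z, of p] ortho_antimono[OF meet_le(1)[OF z, of q]]
    unfolding homogeneity_def orthogonal_def by (blast intro: order_trans)
  ultimately show ?thesis
    using h I z by (simp add: homogeneity_def complete_over_meet)
qed

lemma homogeneity_eq_bot: "homogeneity I Z p p \<Longrightarrow> p = bot"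
  by (simp add: homogeneity_def orthogonal_def le_ortho_self)

lemma homogeneity_bot:
  assumes "homogeneity I Z p q" "p = bot"
  shows "q = bot"
proof -
  have "bot \<in> Z" using Lub_in[of "{}" bot] by (auto simp: isLub_UNIV_iff)
  with assms show ?thesis by (auto simp: homogeneity_def same_upper_iff bot_unique)
qed

text \<open>Cutting every member of a witness down to \<open>z\<close> gives a witness for
  \<open>meet p z\<close>. If two distinct members had the same cut, it would be orthogonal to
  itself, hence zero; then all cuts vanish, contrary to
  \<open>meet p z \<noteq> bot\<close>.\<close>

lemma homogeneous_of_order_meet:
  assumes A: "complete_over Z A" and I: "complete_over Z I" and z: "z \<in> Z"
    and p: "homogeneous_of_order A (homogeneity I Z) \<kappa> p" and nz: "meet p z \<noteq> bot"
  shows "homogeneous_of_order A (homogeneity I Z) \<kappa> (meet p z)"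
proof -
  from p obtain S where S: "S \<subseteq> A" "isLub UNIV S p" "pairwise (homogeneity I Z) S"
    "cardinality S = \<kappa>"
    unfolding homogeneous_of_order_def by blast
  let ?f = "\<lambda>t. meet t z"
  have f: "homogeneity I Z (?f s) (?f t)" if "s \<in> S" "t \<in> S" "s \<noteq> t" for s t
    using that S(3) by (intro homogeneity_meet I z) (auto simp: pairwise_def)
  have lub: "isLub UNIV (?f ` S) (meet p z)" using S(2) z by (rule meet_isLub)
  have "inj_on ?f S"
  proof (rule inj_onI, rule ccontr)
    fix s t assume st: "s \<in> S" "t \<in> S" "?f s = ?f t" "s \<noteq> t"
    with f[OF st(1,2,4)] have bot: "?f s = bot" using homogeneity_eq_bot by simp
    have "?f u = bot" if "u \<in> S" for u
      using homogeneity_bot[OF f[OF st(1) that]] bot by (cases "u = s") auto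
    then have "meet p z \<le> bot" using lub by (simp add: isLub_UNIV_iff)
    with nz show False by (simp add: bot_unique)
  qed
  then have "cardinality (?f ` S) = \<kappa>"
    using S(4) cardinality_eq_iff inj_on_image_eqpoll_self by metis
  moreover have "?f ` S \<subseteq> A" using S(1) A z by (auto intro: complete_over_meet)
  moreover have "pairwise (homogeneity I Z) (?f ` S)"
    using f by (auto simp: pairwise_def)
  ultimately show ?thesis using lub unfolding homogeneous_of_order_def by blast
qed

text \<open>The witnesses of all \<open>s\<close> in \<open>S\<close> are enumerated by one index
  set \<open>K\<close>, and members with the same index are merged into one element.\<close>

lemma homogeneous_of_order_Lub:
  assumes A: "complete_over Z A" and I: "complete_over Z I"
    and S: "pairwise separated S" "S \<noteq> {}" "isLub UNIV S s0"
    and h: "\<And>s. s \<in> S \<Longrightarrow> homogeneous_of_order A (homogeneity I Z) \<kappa> s"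
  shows "homogeneous_of_order A (homogeneity I Z) \<kappa> s0"
proof -
  obtain W where W: "\<And>s. s \<in> S \<Longrightarrow> W s \<subseteq> A \<and> isLub UNIV (W s) s \<and>
      pairwise (homogeneity I Z) (W s) \<and> cardinality (W s) = \<kappa>"
    using h unfolding homogeneous_of_order_def by metis
  obtain K where K: "cardinality K = \<kappa>" using W S(2) by blast
  have "\<exists>g. bij_betw g K (W s)" if "s \<in> S" for s
    using W[OF that] K cardinality_eq_iff unfolding eqpoll_def by metis
  then obtain g where g: "\<And>s. s \<in> S \<Longrightarrow> bij_betw (g s) K (W s)" by metis
  have gW: "g s k \<in> W s" if "s \<in> S" "k \<in> K" for s k
    using bij_betwE[OF g] that by blast
  have gs: "g s k \<le> s" if "s \<in> S" "k \<in> K" for s k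
    using W[OF that(1)] gW[OF that] unfolding isLub_UNIV_iff by blast
  have ginj: "g s k \<noteq> g s l" if "s \<in> S" "k \<in> K" "l \<in> K" "k \<noteq> l" for s k l
    using bij_betw_imp_inj_on[OF g[OF that(1)]] that(2-4) by (simp add: inj_on_eq_iff)
  have gh: "homogeneity I Z (g s k) (g s l)" if "s \<in> S" "k \<in> K" "l \<in> K" "k \<noteq> l" for s k l
    using W[OF that(1)] gW[OF that(1,2)] gW[OF that(1,3)] ginj[OF that] by (blast dest: pairwiseD)
  have sep: "separated (g s k) (g t l)" if "s \<in> S" "t \<in> S" "s \<noteq> t" "k \<in> K" "l \<in> K" for s t k l
    using pairwiseD[OF S(1) that(1-3)] gs[OF that(1,4)] gs[OF that(2,5)] by (rule separated_mono)
  then have sepk: "pairwise separated ((\<lambda>s. g s k) ` S)" if "k \<in> K" for k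
    unfolding pairwise_image using that by (simp add: pairwise_def)
  have "\<exists>x\<in>A. isLub UNIV ((\<lambda>s. g s k) ` S) x" if "k \<in> K" for k
  proof (intro complete_over_Lub A sepk that)
    show "(\<lambda>s. g s k) ` S \<subseteq> A" using W gW that by blast
  qed
  \<comment> \<open>\<open>u k\<close> is the supremum of the \<open>k\<close>-th members over all
    \<open>s\<close>.\<close>
  then obtain u where u: "\<And>k. k \<in> K \<Longrightarrow> u k \<in> A \<and> isLub UNIV ((\<lambda>s. g s k) ` S) (u k)"
    by metis
  then have ule: "u k \<le> y \<longleftrightarrow> (\<forall>s\<in>S. g s k \<le> y)" if "k \<in> K" for k y
    using that by (simp add: isLub_UNIV_iff)
  \<comment> \<open>Membership of \<open>g s k\<close> in \<open>I\<close> comes from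
    \<open>gh\<close>, which requires a second index \<open>l\<close>.\<close>
  have uI: "u k \<in> I" if kl: "k \<in> K" "l \<in> K" "k \<noteq> l" for k l
  proof -
    have "(\<lambda>s. g s k) ` S \<subseteq> I" using gh kl by (auto simp: homogeneity_def)
    then obtain x where x: "x \<in> I" "isLub UNIV ((\<lambda>s. g s k) ` S) x"
      using complete_over_Lub[OF I _ sepk[OF kl(1)]] by metis
    have "u k = x" using u[OF kl(1)] x(2) by (blast intro: isLub_UNIV_unique)
    with x(1) show ?thesis by simp
  qed
  have uo: "orthogonal (u k) (u l)" if kl: "k \<in> K" "l \<in> K" "k \<noteq> l" for k l
  proof -
    \<comment> \<open>Within one \<open>s\<close> orthogonality comes from homogeneity, across
      different ones from separation.\<close>
    have le: "g s k \<le> ortho (g t l)" if st: "s \<in> S" "t \<in> S" for s t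
    proof (cases "s = t")
      case True
      with gh[OF st(1) kl] show ?thesis by (simp add: homogeneity_def orthogonal_def)
    next
      case False
      from separated_orthogonal[OF sep[OF st False kl(1,2)]] show ?thesis
        by (simp add: orthogonal_def)
    qed
    have "g t l \<le> ortho (u k)" if "t \<in> S" for t
      using le that by (simp add: ule[OF kl(1)] le_ortho_sym[of "u k"])
    then have "u l \<le> ortho (u k)" by (simp add: ule[OF kl(2)])
    then show ?thesis unfolding orthogonal_def by (rule le_ortho_sym)
  qed
  have uh: "homogeneity I Z (u k) (u l)" if kl: "k \<in> K" "l \<in> K" "k \<noteq> l" for k l
  proof -
    have "g s k \<le> z \<longleftrightarrow> g s l \<le> z" if "s \<in> S" "z \<in> Z" for s z
      using gh[OF that(1) kl] that(2) by (simp add: homogeneity_def same_upper_iff)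
    then have "same_upper Z (u k) (u l)" by (simp add: same_upper_iff ule kl)
    then show ?thesis using kl by (simp add: homogeneity_def uI[of k l] uI[of l k] uo)
  qed
  \<comment> \<open>A coincidence \<open>u k = u l\<close> would be zero, so \<open>g s k\<close>
    and \<open>g s l\<close> would both be zero for some \<open>s\<close>, against injectivity of
    \<open>g s\<close>.\<close>
  have "inj_on u K"
  proof (rule inj_onI, rule ccontr)
    fix k l assume kl: "k \<in> K" "l \<in> K" "u k = u l" "k \<noteq> l"
    then have "u k = bot" "u l = bot" using uh[of k l] homogeneity_eq_bot by auto
    with kl have "\<forall>s\<in>S. g s k \<le> bot \<and> g s l \<le> bot" by (metis order_refl ule)
    with S(2) ginj kl show False by (metis bot_unique ex_in_conv)
  qed
  then have "cardinality (u ` K) = \<kappa>"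
    using K cardinality_eq_iff inj_on_image_eqpoll_self by metis
  moreover have "u ` K \<subseteq> A" using u by blast
  moreover have "pairwise (homogeneity I Z) (u ` K)" using uh by (auto simp: pairwise_def)
  \<comment> \<open>Suprema over \<open>s\<close> and over \<open>k\<close> may be
    interchanged.\<close>
  moreover have "isLub UNIV (u ` K) s0"
  proof -
    have "s \<le> y \<longleftrightarrow> (\<forall>k\<in>K. g s k \<le> y)" if "s \<in> S" for s y
    proof -
      have "isLub UNIV (g s ` K) s" using W[OF that] bij_betw_imp_surj_on[OF g[OF that]] by simp
      then show ?thesis by (simp add: isLub_UNIV_iff)
    qed
    then have "s0 \<le> y \<longleftrightarrow> (\<forall>s\<in>S. \<forall>k\<in>K. g s k \<le> y)" for y
      using S(3) by (simp add: isLub_UNIV_iff)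
    then show ?thesis by (auto simp: isLub_UNIV_iff ule)
  qed
  ultimately show ?thesis unfolding homogeneous_of_order_def by blast
qed

section \<open>Homogeneous elements of \<open>Z\<close> and a partition of \<open>top\<close> into
  them\<close>

lemma ex_homogeneous_below:
  assumes dense: "order_dense I" and I: "complete_over Z I" and z: "z \<in> Z" "z \<noteq> bot"
  obtains w where "w \<in> Z" "w \<noteq> bot" "w \<le> z" "homogeneous I (homogeneity I Z) w"
proof -
  obtain p where p: "p \<in> I" "p \<noteq> bot" "p \<le> z" using dense z(2) unfolding order_dense_def by blast
  obtain S where S: "S \<subseteq> {q\<in>I. same_upper Z q p}" "pairwise orthogonal S"
    and Smax: "\<And>x. x \<in> {q\<in>I. same_upper Z q p} \<Longrightarrow>
      (\<And>y. y \<in> S \<Longrightarrow> orthogonal x y \<and> orthogonal y x) \<Longrightarrow> x \<in> S"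
    by (rule maximal_pairwise_subset[of "{q\<in>I. same_upper Z q p}" orthogonal]) blast
  obtain s where s: "isLub UNIV S s" using orthocomplete S(2) unfolding orthocomplete_def by blast
  then have le_s: "x \<le> s" if "x \<in> S" for x using that by (auto simp: isLub_UNIV_iff)
  define w where "w = cover p"
  have w: "w \<in> Z" "w \<le> z" "p \<le> w" using p z by (auto simp: w_def cover_le_iff le_cover)
  define r where "r = meet (ortho s) w"
  have r: "r \<le> ortho s" "r \<le> w" using w(1) by (auto simp: r_def meet_le)
  obtain Q where Q: "Q \<subseteq> {q\<in>I. q \<le> r}" "pairwise separated Q"
    and Qmax: "\<And>x. x \<in> {q\<in>I. q \<le> r} \<Longrightarrow>
      (\<And>y. y \<in> Q \<Longrightarrow> separated x y \<and> separated y x) \<Longrightarrow> x \<in> Q"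
    by (rule maximal_pairwise_subset[of "{q\<in>I. q \<le> r}" separated]) blast
  obtain q where q: "q \<in> I" "isLub UNIV Q q" using complete_over_Lub[OF I _ Q(2)] Q(1) by blast
  then have le_q: "x \<le> q" if "x \<in> Q" for x using that by (auto simp: isLub_UNIV_iff)
  have "q \<le> r" using q(2) Q(1) by (auto simp: isLub_UNIV_iff)
  define v where "v = cover q"
  have v: "v \<in> Z" "q \<le> v" "ortho v \<in> Z" by (auto simp: v_def le_cover ortho_in)
  define w0 where "w0 = meet w (ortho v)"
  have w0: "w0 \<in> Z" "w0 \<le> w" "w0 \<le> ortho v" using w v by (auto simp: w0_def meet_in meet_le)
  have "w0 \<noteq> bot"
  proof
    assume "w0 = bot"
    \<comment> \<open>Now \<open>v = w\<close>, so \<open>q\<close> could join \<open>S\<close>.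
      Then \<open>q\<close> lies below both \<open>s\<close> and \<open>ortho s\<close>, and
      \<open>q = bot\<close> forces \<open>p = bot\<close>.\<close>
    then have "meet w (ortho v) \<le> v" by (simp add: w0_def)
    then have "w \<le> v" using v(1) meet_le(2)[OF v(1)] by (blast intro: le_by_parts)
    moreover have "v \<le> w" using \<open>q \<le> r\<close> r(2) w(1) by (auto simp: v_def cover_le_iff intro: order_trans)
    ultimately have same: "same_upper Z q p" by (simp add: same_upper_iff_cover v_def w_def)
    have qs: "q \<le> ortho s" using \<open>q \<le> r\<close> r(1) by (rule order_trans)
    have "orthogonal q x \<and> orthogonal x q" if "x \<in> S" for x
      using order_trans[OF qs ortho_antimono[OF le_s[OF that]]] le_ortho_sym
      unfolding orthogonal_def by blast
    with q(1) same have "q \<in> S" using Smax by simp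
    then have "q \<le> bot" using le_s qs by (blast intro: inf_ortho_le)
    moreover have "bot \<in> Z" using \<open>w0 = bot\<close> w0(1) by simp
    ultimately show False using same p(2) by (auto simp: same_upper_iff bot_unique)
  qed
  have "meet (ortho s) w0 = bot"
  proof (rule ccontr)
    assume "meet (ortho s) w0 \<noteq> bot"
    then obtain x where x: "x \<in> I" "x \<noteq> bot" "x \<le> meet (ortho s) w0"
      using dense unfolding order_dense_def by blast
    then have xle: "x \<le> ortho s" "x \<le> w0" using w0(1) by auto
    then have "x \<le> r" using w0(2) w(1) by (auto simp: r_def intro: order_trans)
    \<comment> \<open>\<open>x\<close> lies below \<open>ortho v\<close> and \<open>q\<close> below
      \<open>v\<close>. So \<open>x\<close> can join \<open>Q\<close>, which puts it below
      \<open>q\<close> and makes it orthogonal to itself.\<close>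
    moreover have xq: "separated x q"
      using xle w0 v by (intro separatedI[of "ortho v" v]) (auto simp: orthogonal_def intro: order_trans)
    then have "separated x y \<and> separated y x" if "y \<in> Q" for y
      using separated_mono[OF xq order_refl le_q[OF that]] separated_sym by blast
    ultimately have "x \<in> Q" using x(1) Qmax by simp
    then have "orthogonal x x" using separated_orthogonal[OF separated_mono[OF xq order_refl le_q]] by blast
    with x(2) show False by (simp add: orthogonal_def le_ortho_self)
  qed
  then have "ortho s \<le> ortho w0"
    using le_by_parts[OF w0(1), of "ortho s"] meet_le(2)[OF ortho_in[OF w0(1)]] by simp
  then have "w0 \<le> s" by (metis le_ortho_sym ortho_ortho)
  \<comment> \<open>Thus cutting the witness \<open>S\<close> of \<open>s\<close> down to
    \<open>w0\<close> yields a witness of \<open>w0\<close> itself.\<close>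
  then have "meet s w0 = w0" using w0(1) by (simp add: meet_le order.antisym)
  moreover have "pairwise (homogeneity I Z) S"
  proof (rule pairwiseI)
    fix x y assume "x \<in> S" "y \<in> S" "x \<noteq> y"
    with S show "homogeneity I Z x y"
      unfolding homogeneity_def same_upper_def by (blast dest: pairwiseD)
  qed
  with S(1) s have "homogeneous_of_order I (homogeneity I Z) (cardinality S) s"
    unfolding homogeneous_of_order_def by blast
  ultimately have "homogeneous I (homogeneity I Z) w0"
    using homogeneous_of_order_meet[OF I I w0(1)] \<open>w0 \<noteq> bot\<close>
    unfolding homogeneous_iff_of_order by metis
  then show thesis using that w0 w(2) \<open>w0 \<noteq> bot\<close> by (blast intro: order_trans)
qed

text \<open>If the supremum \<open>s\<close> of a maximal family were not \<open>top\<close>, the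
  element \<open>ortho s\<close> of \<open>Z\<close> would dominate a further homogeneous element
  orthogonal to the whole family.\<close>

lemma ex_homogeneous_partition:
  assumes "order_dense I" "complete_over Z I"
  obtains S where "S \<subseteq> Z" "pairwise orthogonal S" "isLub UNIV S top"
    "\<And>s. s \<in> S \<Longrightarrow> homogeneous I (homogeneity I Z) s"
proof -
  let ?D = "{w\<in>Z. homogeneous I (homogeneity I Z) w}"
  obtain S where S: "S \<subseteq> ?D" "pairwise orthogonal S" and
    max: "\<And>x. x \<in> ?D \<Longrightarrow> (\<And>y. y \<in> S \<Longrightarrow> orthogonal x y \<and> orthogonal y x) \<Longrightarrow> x \<in> S"
    by (rule maximal_pairwise_subset[of ?D orthogonal]) blast
  from S have "S \<subseteq> Z" by blast
  then obtain s where s: "s \<in> Z" "isLub UNIV S s" using ex_Lub by blast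
  then have le_s: "x \<le> s" if "x \<in> S" for x using that by (auto simp: isLub_UNIV_iff)
  have "ortho s = bot"
  proof (rule ccontr)
    assume "ortho s \<noteq> bot"
    then obtain w where w: "w \<in> ?D" "w \<noteq> bot" "w \<le> ortho s"
      using ex_homogeneous_below[OF assms ortho_in[OF s(1)]] by blast
    then have "orthogonal w x \<and> orthogonal x w" if "x \<in> S" for x
      using order_trans[OF w(3) ortho_antimono[OF le_s[OF that]]] le_ortho_sym
      unfolding orthogonal_def by blast
    with w(1) have "w \<in> S" using max by blast
    with w show False using le_s inf_ortho_le[of w s] by (simp add: bot_unique)
  qed
  then have "s = top" using sup_ortho_ge[of s s] by (simp add: top_unique)
  with s have "isLub UNIV S top" by simp
  with \<open>S \<subseteq> Z\<close> S show thesis by (intro that) auto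
qed

section \<open>Decomposition of \<open>top\<close> by order, and its uniqueness\<close>

lemma orthogonal_pairwise_separated:
  assumes "S \<subseteq> Z" "pairwise orthogonal S"
  shows "pairwise separated S"
  using assms by (auto simp: pairwise_def intro: separatedI[OF _ _ _ order_refl order_refl])

lemma ex_order_partition:
  assumes A: "complete_over Z A" and I: "complete_over Z I"
    and S: "S \<subseteq> Z" "pairwise orthogonal S" "isLub UNIV S top"
    and h: "\<And>s. s \<in> S \<Longrightarrow> homogeneous A (homogeneity I Z) s"
  obtains z where "range z \<subseteq> Z" "\<And>\<kappa> \<mu>. \<mu> \<noteq> \<kappa> \<Longrightarrow> orthogonal (z \<mu>) (z \<kappa>)"
    "\<And>\<kappa>. z \<kappa> \<in> insert bot (order_part A I Z \<kappa>)" "isLub UNIV (range z) top"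
proof -
  \<comment> \<open>An element may have several orders; \<open>\<tau>\<close> selects one.\<close>
  obtain \<tau> where \<tau>: "\<And>s. s \<in> S \<Longrightarrow> homogeneous_of_order A (homogeneity I Z) (\<tau> s) s"
    using h unfolding homogeneous_iff_of_order by metis
  let ?T = "\<lambda>\<kappa>. {s\<in>S. \<tau> s = \<kappa>}"
  have "\<exists>y\<in>Z. isLub UNIV (?T \<kappa>) y" for \<kappa> using S(1) by (intro ex_Lub) blast
  then obtain z where z: "\<And>\<kappa>. z \<kappa> \<in> Z" "\<And>\<kappa>. isLub UNIV (?T \<kappa>) (z \<kappa>)" by metis
  then have zle: "z \<kappa> \<le> y \<longleftrightarrow> (\<forall>s\<in>?T \<kappa>. s \<le> y)" for \<kappa> y by (simp add: isLub_UNIV_iff)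
  show thesis
  proof (rule that[of z])
    show "range z \<subseteq> Z" using z by blast
  next
    fix \<kappa> \<mu> :: "'a cardinal" assume "\<mu> \<noteq> \<kappa>"
    then have st: "s \<le> ortho t" if "s \<in> ?T \<mu>" "t \<in> ?T \<kappa>" for s t
      using S(2) that by (auto simp: pairwise_def orthogonal_def)
    have "t \<le> ortho (z \<mu>)" if "t \<in> ?T \<kappa>" for t
    proof (rule le_ortho_sym)
      show "z \<mu> \<le> ortho t" unfolding zle using st that by blast
    qed
    then have "z \<kappa> \<le> ortho (z \<mu>)" unfolding zle by blast
    then show "orthogonal (z \<mu>) (z \<kappa>)" unfolding orthogonal_def by (rule le_ortho_sym)
  next
    fix \<kappa>
    show "z \<kappa> \<in> insert bot (order_part A I Z \<kappa>)"
    proof (cases "?T \<kappa> = {}")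
      \<comment> \<open>For an order that \<open>\<tau>\<close> never takes,
        \<open>z \<kappa>\<close> is the supremum of the empty set.\<close>
      case True
      then have "z \<kappa> \<le> bot" using zle by auto
      then show ?thesis by (simp add: bot_unique)
    next
      case False
      have "pairwise separated (?T \<kappa>)"
        using orthogonal_pairwise_separated[OF S(1,2)] by (rule pairwise_subset) blast
      then have "homogeneous_of_order A (homogeneity I Z) \<kappa> (z \<kappa>)"
        using False z(2) by (rule homogeneous_of_order_Lub[OF A I]) (use \<tau> in blast)
      then show ?thesis by (simp add: order_part_def)
    qed
  next
    have "(\<forall>\<kappa>. z \<kappa> \<le> y) \<longleftrightarrow> (\<forall>s\<in>S. s \<le> y)" for y using zle by auto
    then show "isLub UNIV (range z) top" using S(3) by (simp add: isLub_UNIV_iff)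
  qed
qed

text \<open>\<open>y\<close> is the supremum of its meets with the \<open>z \<mu>\<close>, and those
  with \<open>\<mu> \<noteq> \<kappa>\<close> vanish. Comparing two families both ways gives
  uniqueness.\<close>

lemma order_partition_le:
  assumes A: "complete_over Z A" and I: "complete_over Z I"
    and disj: "\<And>\<kappa> \<mu>. \<mu> \<noteq> \<kappa> \<Longrightarrow> order_part A I Z \<mu> \<inter> order_part A I Z \<kappa> \<inter> Z \<subseteq> {bot}"
    and y: "y \<in> Z" "y \<in> insert bot (order_part A I Z \<kappa>)"
    and z: "range z \<subseteq> Z" "\<And>\<kappa>. z \<kappa> \<in> insert bot (order_part A I Z \<kappa>)" "isLub UNIV (range z) top"
  shows "y \<le> z \<kappa>"
proof -
  have "meet (z \<mu>) y \<le> z \<kappa>" for \<mu>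
  proof (cases "\<mu> = \<kappa>")
    case True
    then show ?thesis using y(1) by (simp add: meet_le)
  next
    case False
    have zZ: "z \<mu> \<in> Z" using z(1) by blast
    have "meet (z \<mu>) y = bot"
    proof (rule ccontr)
      assume nz: "meet (z \<mu>) y \<noteq> bot"
      with meet_le[OF y(1), of "z \<mu>"] have "z \<mu> \<noteq> bot" "y \<noteq> bot" by (auto simp: bot_unique)
      then have "z \<mu> \<in> order_part A I Z \<mu>" "y \<in> order_part A I Z \<kappa>" using y(2) z(2)[of \<mu>] by auto
      \<comment> \<open>The meet is \<open>z \<mu>\<close> cut down by \<open>y\<close> and also
        \<open>y\<close> cut down by \<open>z \<mu>\<close>, so it inherits both orders.\<close>
      then have "meet (z \<mu>) y \<in> order_part A I Z \<mu>" "meet (z \<mu>) y \<in> order_part A I Z \<kappa>"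
        using homogeneous_of_order_meet[OF A I y(1), of \<mu> "z \<mu>"]
          homogeneous_of_order_meet[OF A I zZ, of \<kappa> y] nz
        by (auto simp: order_part_def meet_commute)
      with disj[OF False] meet_in[OF zZ y(1)] nz show False by blast
    qed
    then show ?thesis by simp
  qed
  then show ?thesis
    using meet_isLub[OF z(3) y(1)] by (simp add: isLub_UNIV_iff meet_top[OF y(1)])
qed

end

theorem theorem5p2:
  fixes I Z :: "'a::orthoposet set"
  assumes "orthocomplete TYPE('a)"
    and "Z \<subseteq> centre"
    and "complete_sublattice Z"
    and "ortho ` Z = Z"
    and "order_dense I"
    and "complete_over Z I"
  shows "\<forall>A\<in>{UNIV, I}.
    subhomogeneous A Z (homogeneity I Z) top \<and>
    ((\<forall>\<kappa> \<mu>. \<mu> \<noteq> \<kappa> \<longrightarrow> order_part A I Z \<mu> \<inter> order_part A I Z \<kappa> \<inter> Z \<subseteq> {bot}) \<longrightarrow>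
      (\<exists>!z :: 'a cardinal \<Rightarrow> 'a.
        range z \<subseteq> Z \<and>
        (\<forall>\<kappa> \<mu>. \<mu> \<noteq> \<kappa> \<longrightarrow> orthogonal (z \<mu>) (z \<kappa>)) \<and>
        (\<forall>\<kappa>. z \<kappa> \<in> insert bot (order_part A I Z \<kappa>)) \<and>
        isLub UNIV (range z) top))"
proof (intro ballI conjI impI)
  interpret central_sublattice Z using assms by unfold_locales
  fix A assume A: "A \<in> {UNIV, I}"
  then have cA: "complete_over Z A" using assms(6) complete_over_UNIV by auto
  obtain S where S: "S \<subseteq> Z" "pairwise orthogonal S" "isLub UNIV S top"
    and hI: "\<And>s. s \<in> S \<Longrightarrow> homogeneous I (homogeneity I Z) s"
    by (fact ex_homogeneous_partition[OF assms(5,6)])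
  \<comment> \<open>Witnesses drawn from \<open>I\<close> serve for either choice of
    \<open>A\<close>.\<close>
  from A have "I \<subseteq> A" by auto
  then have hS: "homogeneous A (homogeneity I Z) s" if "s \<in> S" for s
    using hI[OF that] unfolding homogeneous_def by (meson order_trans)
  show "subhomogeneous A Z (homogeneity I Z) top"
    unfolding subhomogeneous_def disjoint_over_iff
    using S(3) orthogonal_pairwise_separated[OF S(1,2)] hS by (intro exI[of _ S] conjI ballI)
  assume "\<forall>\<kappa> \<mu>. \<mu> \<noteq> \<kappa> \<longrightarrow> order_part A I Z \<mu> \<inter> order_part A I Z \<kappa> \<inter> Z \<subseteq> {bot}"
  then have disj:
    "\<And>\<kappa> \<mu>. \<mu> \<noteq> \<kappa> \<Longrightarrow> order_part A I Z \<mu> \<inter> order_part A I Z \<kappa> \<inter> Z \<subseteq> {bot}" by blast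
  let ?P = "\<lambda>z :: 'a cardinal \<Rightarrow> 'a. range z \<subseteq> Z \<and>
    (\<forall>\<kappa> \<mu>. \<mu> \<noteq> \<kappa> \<longrightarrow> orthogonal (z \<mu>) (z \<kappa>)) \<and>
    (\<forall>\<kappa>. z \<kappa> \<in> insert bot (order_part A I Z \<kappa>)) \<and> isLub UNIV (range z) top"
  obtain z where "range z \<subseteq> Z" "\<And>\<kappa> \<mu>. \<mu> \<noteq> \<kappa> \<Longrightarrow> orthogonal (z \<mu>) (z \<kappa>)"
    "\<And>\<kappa>. z \<kappa> \<in> insert bot (order_part A I Z \<kappa>)" "isLub UNIV (range z) top"
    by (rule ex_order_partition[OF cA assms(6) S]) (rule hS, assumption, rule that)
  then have z: "?P z" by blast
  have le: "y \<kappa> \<le> x \<kappa>" if "?P y" "?P x" for x y \<kappa>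
  proof (rule order_partition_le[OF cA assms(6)])
    show "y \<kappa> \<in> Z" "y \<kappa> \<in> insert bot (order_part A I Z \<kappa>)" using that(1) by blast+
    show "range x \<subseteq> Z" "isLub UNIV (range x) top" using that(2) by blast+
    show "x \<mu> \<in> insert bot (order_part A I Z \<mu>)" for \<mu> using that(2) by blast
  qed (rule disj)
  show "\<exists>!z. ?P z"
  proof (rule ex1I[of ?P, OF z])
    fix y assume y: "?P y"
    show "y = z"
    proof
      fix \<kappa>
      show "y \<kappa> = z \<kappa>" using le[OF y z] le[OF z y] by (rule order.antisym)
    qed
  qed
qed

end
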